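(* Let $G\in\pi_n(\gamma_1,\gamma_2)$ and let $g$ be the $h$--$\gamma$ blossom of $G$. Let $h\neq0$. Then there are $n!$ recursive evaluation algorithms for $G(x)$, one for each permutation $\sigma$ of $\{1,\ldots,n\}$, as follows. Let $a,b\in\mathbb R$ be such that $d(a-jh,b-ih)\neq0$ for $0\le i\le j\le n-1$, and let $\sigma$ be a permutation of $\{1,\ldots,n\}$. Set $$P_i^0=g\big(\Gamma(a-ih),\ldots,\Gamma(a-(n-1)h),\Gamma(b),\Gamma(b-h),\ldots,\Gamma(b-(i-1)h);h\big),\quad i=0,\ldots,n,$$ and define recursively $$P_i^{k+1}(x)=\frac{d(x-(\sigma(k+1)-1)h,\,b-ih)}{d(a-(i+k)h,\,b-ih)}\,P_i^k(x)+\frac{d(a-(i+k)h,\,x-(\sigma(k+1)-1)h)}{d(a-(i+k)h,\,b-ih)}\,P_{i+1}^k(x)$$ for $i=0,\ldots,n-k-1$ and $k=0,\ldots,n-1$. Then for all $x\in\mathbb R$ $$P_i^k(x)=g\big(\Gamma(a-(k+i)h),\ldots,\Gamma(a-(n-1)h),\Gamma(b),\Gamma(b-h),\ldots,\Gamma(b-(i-1)h),\Gamma(x-(\sigma(1)-1)h),\ldots,\Gamma(x-(\sigma(k)-1)h);h\big)$$ for $i=0,\ldots,n-k$, $k=0,\ldots,n$. In particular, $$P_0^n(x)=g\big(\Gamma(x-(\sigma(1)-1)h),\ldots,\Gamma(x-(\sigma(n)-1)h);h\big)=G(x).$$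
   Context: Let $n\ge 1$ be an integer and $h\in\mathbb R$ fixed. Let $\gamma_1,\gamma_2:\mathbb R\to\mathbb R$ be continuous, linearly independent functions, and write $\Gamma(t)=(\gamma_1(t),\gamma_2(t))$. They are assumed translation invariant: for every $s\in\mathbb R$ there is an invertible $2\times2$ matrix $C(s)$ with $\begin{pmatrix}\gamma_1(x-s)\\ \gamma_2(x-s)\end{pmatrix}=C(s)\begin{pmatrix}\gamma_1(x)\\ \gamma_2(x)\end{pmatrix}$ for all $x$. Put $\pi_n(\gamma_1,\gamma_2)=\mathrm{span}\{\gamma_1^{n-k}\gamma_2^{k}\}_{k=0}^n$ and $d(u,v)=\gamma_1(u)\gamma_2(v)-\gamma_2(u)\gamma_1(v)$. For $0\le k\le n$ put $G_{n,k}(t;h)=\sum_{I\subseteq\{1,\ldots,n\},\,|I|=k}\ \prod_{i\in I}\gamma_1(t-(i-1)h)\prod_{i\in\{1,\ldots,n\}\setminus I}\gamma_2(t-(i-1)h)$. Standing assumption: $h$ is such that the functions $t\mapsto G_{n,k}(t;h)$, $k=0,\ldots,n$, are linearly independent. The $h$--$\gamma$ blossom of $G\in\pi_n(\gamma_1,\gamma_2)$ is the (unique, existing) function $g(\cdot\,;h):(\mathbb R^2)^n\to\mathbb R$ that is symmetric, linear in each of its $n$ arguments in $\mathbb R^2$, and satisfies $g(\Gamma(t),\Gamma(t-h),\ldots,\Gamma(t-(n-1)h);h)=G(t)$ for all $t$. Argument lists of the form $\Gamma(a-mh),\ldots,\Gamma(a-(n-1)h)$ with $m=n$, or $\Gamma(b),\ldots,\Gamma(b-(i-1)h)$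 with $i=0$, are empty; $P_i^0(x)=P_i^0$ is constant in $x$. *)

theory Defs
  imports
    "HOL-Analysis.Analysis"
    "HOL-Combinatorics.Permutations"
    "HOL-Library.Function_Algebras"
begin

text \<open>The real vector space of functions \<^typ>\<open>real \<Rightarrow> real\<close>. The addition on functions is the pointwise
  one of \<^theory>\<open>HOL-Library.Function_Algebras\<close>; there is no \<^class>\<open>real_vector\<close> instance for functions,
  so span and independence come from the locale \<^locale>\<open>vector_space\<close>.\<close>

global_interpretation fun_space: vector_space "\<lambda>(c::real) (f::real \<Rightarrow> real) x. c * f x"
  defines fun_span = fun_space.span
    and fun_dependent = fun_space.dependent
  by unfold_locales (auto simp: fun_eq_iff algebra_simps)

text \<open>For a family, as opposed to a set, repeated members count as dependent.\<close>

definition lin_indep_family :: "(nat \<Rightarrow> real \<Rightarrow> real) \<Rightarrow> nat set \<Rightarrow> bool" where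
  "lin_indep_family F K \<longleftrightarrow> inj_on F K \<and> \<not> fun_dependent (F ` K)"

definition curve :: "(real \<Rightarrow> real) \<Rightarrow> (real \<Rightarrow> real) \<Rightarrow> real \<Rightarrow> real ^ 2" where
  "curve \<gamma>1 \<gamma>2 t = vector [\<gamma>1 t, \<gamma>2 t]"

definition translation_invariant :: "(real \<Rightarrow> real) \<Rightarrow> (real \<Rightarrow> real) \<Rightarrow> bool" where
  "translation_invariant \<gamma>1 \<gamma>2 \<longleftrightarrow>
     (\<forall>s. \<exists>C :: real ^ 2 ^ 2. invertible C \<and> (\<forall>x. curve \<gamma>1 \<gamma>2 (x - s) = C *v curve \<gamma>1 \<gamma>2 x))"

definition pi_space :: "(real \<Rightarrow> real) \<Rightarrow> (real \<Rightarrow> real) \<Rightarrow> nat \<Rightarrow> (real \<Rightarrow> real) set" where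
  "pi_space \<gamma>1 \<gamma>2 n = fun_span ((\<lambda>k t. \<gamma>1 t ^ (n - k) * \<gamma>2 t ^ k) ` {0..n})"

definition dd :: "(real \<Rightarrow> real) \<Rightarrow> (real \<Rightarrow> real) \<Rightarrow> real \<Rightarrow> real \<Rightarrow> real" where
  "dd \<gamma>1 \<gamma>2 u v = \<gamma>1 u * \<gamma>2 v - \<gamma>2 u * \<gamma>1 v"

definition GG :: "(real \<Rightarrow> real) \<Rightarrow> (real \<Rightarrow> real) \<Rightarrow> real \<Rightarrow> nat \<Rightarrow> nat \<Rightarrow> real \<Rightarrow> real" where
  "GG \<gamma>1 \<gamma>2 h n k t =
     (\<Sum>I | I \<subseteq> {1..n} \<and> card I = k.
        (\<Prod>i\<in>I. \<gamma>1 (t - (real i - 1) * h)) * (\<Prod>i\<in>{1..n} - I. \<gamma>2 (t - (real i - 1) * h)))"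

text \<open>Functions on the \<open>n\<close>-fold power of the plane are represented by functions on lists, of which
  only the values on lists of length \<open>n\<close> matter.\<close>

definition symmetric_fun :: "nat \<Rightarrow> ((real ^ 2) list \<Rightarrow> real) \<Rightarrow> bool" where
  "symmetric_fun n g \<longleftrightarrow>
     (\<forall>p xs. p permutes {..<n} \<and> length xs = n \<longrightarrow> g (permute_list p xs) = g xs)"

definition multilinear_fun :: "nat \<Rightarrow> ((real ^ 2) list \<Rightarrow> real) \<Rightarrow> bool" where
  "multilinear_fun n g \<longleftrightarrow>
     (\<forall>xs i. length xs = n \<and> i < n \<longrightarrow> linear (\<lambda>v. g (xs[i := v])))"

definition is_blossom ::
  "(real \<Rightarrow> real) \<Rightarrow> (real \<Rightarrow> real) \<Rightarrow> real \<Rightarrow> nat \<Rightarrow> (real \<Rightarrow> real) \<Rightarrow> ((real ^ 2) list \<Rightarrow> real) \<Rightarrow> bool" where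
  "is_blossom \<gamma>1 \<gamma>2 h n G g \<longleftrightarrow>
     symmetric_fun n g \<and> multilinear_fun n g \<and>
     (\<forall>t. g (map (\<lambda>j. curve \<gamma>1 \<gamma>2 (t - real j * h)) [0..<n]) = G t)"

text \<open>The argument list
  \<open>\<Gamma>(a - m h), \<dots>, \<Gamma>(a - (n-1) h), \<Gamma>(b), \<dots>, \<Gamma>(b - (i-1) h)\<close>.\<close>

definition ab_args ::
  "(real \<Rightarrow> real) \<Rightarrow> (real \<Rightarrow> real) \<Rightarrow> real \<Rightarrow> nat \<Rightarrow> real \<Rightarrow> real \<Rightarrow> nat \<Rightarrow> nat \<Rightarrow> (real ^ 2) list" where
  "ab_args \<gamma>1 \<gamma>2 h n a b m i =
     map (\<lambda>j. curve \<gamma>1 \<gamma>2 (a - real j * h)) [m..<n] @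
     map (\<lambda>j. curve \<gamma>1 \<gamma>2 (b - real j * h)) [0..<i]"

text \<open>The argument list \<open>\<Gamma>(x - (\<sigma>(1)-1) h), \<dots>, \<Gamma>(x - (\<sigma>(k)-1) h)\<close>.\<close>

definition x_args ::
  "(real \<Rightarrow> real) \<Rightarrow> (real \<Rightarrow> real) \<Rightarrow> real \<Rightarrow> (nat \<Rightarrow> nat) \<Rightarrow> nat \<Rightarrow> real \<Rightarrow> (real ^ 2) list" where
  "x_args \<gamma>1 \<gamma>2 h \<sigma> k x = map (\<lambda>j. curve \<gamma>1 \<gamma>2 (x - (real (\<sigma> j) - 1) * h)) [1..<k + 1]"

text \<open>\<open>PP \<gamma>1 \<gamma>2 h n g a b \<sigma> k i x\<close> is \<open>P\<^sub>i\<^sup>k(x)\<close>. It is meaningful for \<open>k \<le> n\<close> and \<open>i \<le> n - k\<close>, and in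
  this range the recursion does not leave the range.\<close>

primrec PP ::
  "(real \<Rightarrow> real) \<Rightarrow> (real \<Rightarrow> real) \<Rightarrow> real \<Rightarrow> nat \<Rightarrow> ((real ^ 2) list \<Rightarrow> real) \<Rightarrow> real \<Rightarrow> real \<Rightarrow>
   (nat \<Rightarrow> nat) \<Rightarrow> nat \<Rightarrow> nat \<Rightarrow> real \<Rightarrow> real" where
  "PP \<gamma>1 \<gamma>2 h n g a b \<sigma> 0 = (\<lambda>i x. g (ab_args \<gamma>1 \<gamma>2 h n a b i i))"
| "PP \<gamma>1 \<gamma>2 h n g a b \<sigma> (Suc k) = (\<lambda>i x.
     dd \<gamma>1 \<gamma>2 (x - (real (\<sigma> (k + 1)) - 1) * h) (b - real i * h)
       / dd \<gamma>1 \<gamma>2 (a - real (i + k) * h) (b - real i * h) * PP \<gamma>1 \<gamma>2 h n g a b \<sigma> k i x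
     + dd \<gamma>1 \<gamma>2 (a - real (i + k) * h) (x - (real (\<sigma> (k + 1)) - 1) * h)
       / dd \<gamma>1 \<gamma>2 (a - real (i + k) * h) (b - real i * h) * PP \<gamma>1 \<gamma>2 h n g a b \<sigma> k (i + 1) x)"

end

(* Cramer's rule writes any value of the curve in the basis given by two values a, b with
   d(a, b) nonzero: d(a, b) C(x) = d(x, b) C(a) + d(a, x) C(b). Substituted into one argument of the
   symmetric multilinear blossom, with a and b shifted, this is exactly the recursion, so each step
   trades a shifted copy of a or b for one shifted copy of x. After n steps all arguments are
   shifts of x, and by symmetry their order, hence the permutation, is irrelevant. *)

theory Submission
  imports Defs
begin

text \<open>Equal multisets mean that one list is a permutation of the other, so every later
  rearrangement of arguments reduces to a multiset equation.\<close>

lemma symmetric_fun_mset_cong: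
  assumes "symmetric_fun n g" "length ys = n" "mset xs = mset ys"
  shows "g xs = g ys"
proof -
  obtain p where "p permutes {..<length ys}" "permute_list p ys = xs"
    using mset_eq_permutation[OF assms(3)] by metis
  then show ?thesis
    using assms(1,2) unfolding symmetric_fun_def by auto
qed

lemma curve_cramer:
  assumes "dd \<gamma>1 \<gamma>2 u v \<noteq> 0"
  shows "curve \<gamma>1 \<gamma>2 t =
    (dd \<gamma>1 \<gamma>2 t v / dd \<gamma>1 \<gamma>2 u v) *\<^sub>R curve \<gamma>1 \<gamma>2 u +
    (dd \<gamma>1 \<gamma>2 u t / dd \<gamma>1 \<gamma>2 u v) *\<^sub>R curve \<gamma>1 \<gamma>2 v"
proof -
  \<comment> \<open>Cleared of denominators, each coordinate of Cramer's rule is a polynomial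
    identity.\<close>
  have "dd \<gamma>1 \<gamma>2 u v * \<gamma>1 t = dd \<gamma>1 \<gamma>2 t v * \<gamma>1 u + dd \<gamma>1 \<gamma>2 u t * \<gamma>1 v"
    and "dd \<gamma>1 \<gamma>2 u v * \<gamma>2 t = dd \<gamma>1 \<gamma>2 t v * \<gamma>2 u + dd \<gamma>1 \<gamma>2 u t * \<gamma>2 v"
    by (simp_all add: dd_def algebra_simps)
  then show ?thesis
    using assms by (simp add: vec_eq_iff forall_2 curve_def field_simps)
qed

lemma multilinear_fun_curve_last:
  assumes "multilinear_fun n g" "Suc (length xs) = n" "dd \<gamma>1 \<gamma>2 u v \<noteq> 0"
  shows "g (xs @ [curve \<gamma>1 \<gamma>2 t]) =
    dd \<gamma>1 \<gamma>2 t v / dd \<gamma>1 \<gamma>2 u v * g (xs @ [curve \<gamma>1 \<gamma>2 u]) +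
    dd \<gamma>1 \<gamma>2 u t / dd \<gamma>1 \<gamma>2 u v * g (xs @ [curve \<gamma>1 \<gamma>2 v])"
proof -
  \<comment> \<open>The \<open>0\<close> is a placeholder that brings the list to length
    \<open>n\<close>; the update at index \<open>length xs\<close> overwrites it.\<close>
  have "linear (\<lambda>w. g ((xs @ [0])[length xs := w]))"
    using assms(1,2) unfolding multilinear_fun_def
    by (metis length_append_singleton lessI)
  then have lin: "linear (\<lambda>w. g (xs @ [w]))"
    by simp
  show ?thesis
    by (subst curve_cramer[OF assms(3)]) (simp add: linear_add[OF lin] linear_scale[OF lin])
qed

lemma length_ab_args [simp]: "length (ab_args \<gamma>1 \<gamma>2 h n a b m i) = n - m + i"
  by (simp add: ab_args_def)

lemma length_x_args [simp]: "length (x_args \<gamma>1 \<gamma>2 h \<sigma> k x) = k"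
  by (simp add: x_args_def)

lemma x_args_Suc:
  "x_args \<gamma>1 \<gamma>2 h \<sigma> (Suc k) x =
     x_args \<gamma>1 \<gamma>2 h \<sigma> k x @ [curve \<gamma>1 \<gamma>2 (x - (real (\<sigma> (Suc k)) - 1) * h)]"
  by (simp add: x_args_def)

text \<open>Raising \<open>m\<close> drops the first entry of the \<open>a\<close> block. With its
  analogue for the last entry of the \<open>b\<close> block, this isolates the argument that a
  recursion step replaces.\<close>

lemma mset_ab_args_add_a:
  assumes "m < n"
  shows "mset (ab_args \<gamma>1 \<gamma>2 h n a b m i) =
    add_mset (curve \<gamma>1 \<gamma>2 (a - real m * h)) (mset (ab_args \<gamma>1 \<gamma>2 h n a b (Suc m) i))"
  using assms by (simp add: ab_args_def upt_conv_Cons del: upt_Suc mset_upt)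

lemma mset_ab_args_add_b:
  "mset (ab_args \<gamma>1 \<gamma>2 h n a b m (Suc i)) =
    add_mset (curve \<gamma>1 \<gamma>2 (b - real i * h)) (mset (ab_args \<gamma>1 \<gamma>2 h n a b m i))"
  by (simp add: ab_args_def del: mset_upt)

text \<open>Induction on \<open>k\<close> with \<open>i\<close> arbitrary, because the recursion for
  row \<open>k + 1\<close> at \<open>i\<close> reads row \<open>k\<close> at both \<open>i\<close>
  and \<open>i + 1\<close>.\<close>

lemma PP_eq_blossom:
  assumes sym: "symmetric_fun n g" and multi: "multilinear_fun n g"
    and nz: "\<And>i j. i \<le> j \<Longrightarrow> j < n \<Longrightarrow> dd \<gamma>1 \<gamma>2 (a - real j * h) (b - real i * h) \<noteq> 0"
    and "i + k \<le> n"
  shows "PP \<gamma>1 \<gamma>2 h n g a b \<sigma> k i x =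
    g (ab_args \<gamma>1 \<gamma>2 h n a b (k + i) i @ x_args \<gamma>1 \<gamma>2 h \<sigma> k x)"
  using \<open>i + k \<le> n\<close>
proof (induction k arbitrary: i)
  case 0
  then show ?case by (simp add: x_args_def)
next
  case (Suc k)
  let ?u = "a - real (i + k) * h" and ?v = "b - real i * h"
    and ?t = "x - (real (\<sigma> (Suc k)) - 1) * h"
  \<comment> \<open>These \<open>n - 1\<close> arguments are common to the three blossom values in
    the step; the remaining one is the curve at \<open>?u\<close>, \<open>?v\<close> or
    \<open>?t\<close>.\<close>
  let ?L = "ab_args \<gamma>1 \<gamma>2 h n a b (Suc (k + i)) i @ x_args \<gamma>1 \<gamma>2 h \<sigma> k x"
  have len: "Suc (length ?L) = n"
    using Suc.prems by simp
  have u: "g (ab_args \<gamma>1 \<gamma>2 h n a b (k + i) i @ x_args \<gamma>1 \<gamma>2 h \<sigma> k x) =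
      g (?L @ [curve \<gamma>1 \<gamma>2 ?u])"
    using Suc.prems
    by (intro symmetric_fun_mset_cong[OF sym]) (simp_all add: mset_ab_args_add_a add.commute)
  have v: "g (ab_args \<gamma>1 \<gamma>2 h n a b (k + Suc i) (Suc i) @ x_args \<gamma>1 \<gamma>2 h \<sigma> k x) =
      g (?L @ [curve \<gamma>1 \<gamma>2 ?v])"
    using Suc.prems
    by (intro symmetric_fun_mset_cong[OF sym]) (simp_all add: mset_ab_args_add_b)
  have "g (?L @ [curve \<gamma>1 \<gamma>2 ?t]) =
      dd \<gamma>1 \<gamma>2 ?t ?v / dd \<gamma>1 \<gamma>2 ?u ?v * g (?L @ [curve \<gamma>1 \<gamma>2 ?u]) +
      dd \<gamma>1 \<gamma>2 ?u ?t / dd \<gamma>1 \<gamma>2 ?u ?v * g (?L @ [curve \<gamma>1 \<gamma>2 ?v])"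
    \<comment> \<open>The denominator is nonzero by \<open>nz\<close> with \<open>j = i + k\<close>,
      which is below \<open>n\<close> since \<open>i + Suc k \<le> n\<close>.\<close>
    using Suc.prems by (intro multilinear_fun_curve_last[OF multi len] nz) simp_all
  then show ?case
    using Suc.prems Suc.IH[of i] Suc.IH[of "Suc i"] u v by (simp add: x_args_Suc)
qed

text \<open>\<open>\<sigma>\<close> maps the index set \<open>{1..n}\<close> bijectively to itself,
  so it only reorders the arguments; \<open>Suc\<close> then translates indices from 0 into indices
  from 1.\<close>

lemma mset_x_args_permutes:
  assumes "\<sigma> permutes {1..n}"
  shows "mset (x_args \<gamma>1 \<gamma>2 h \<sigma> n x) =
    mset (map (\<lambda>j. curve \<gamma>1 \<gamma>2 (x - real j * h)) [0..<n])"
proof -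
  let ?f = "\<lambda>j. curve \<gamma>1 \<gamma>2 (x - (real j - 1) * h)"
  have "mset (x_args \<gamma>1 \<gamma>2 h \<sigma> n x) = image_mset ?f (image_mset \<sigma> (mset_set {1..n}))"
    by (simp add: x_args_def image_mset.compositionality o_def atLeastLessThanSuc_atLeastAtMost
        del: upt_Suc)
  also have "image_mset \<sigma> (mset_set {1..n}) = mset_set {1..n}"
    using assms by (simp add: image_mset_mset_set permutes_inj_on permutes_image)
  also have "mset_set {1..n} = image_mset Suc (mset_set {0..<n})"
    by (simp add: image_mset_mset_set image_Suc_atLeastLessThan atLeastLessThanSuc_atLeastAtMost)
  finally show ?thesis
    by (simp add: image_mset.compositionality o_def)
qed

theorem theorem4p2:
  fixes n :: nat and h :: real
    and \<gamma>1 \<gamma>2 :: "real \<Rightarrow> real"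
    and G :: "real \<Rightarrow> real"
    and g :: "(real ^ 2) list \<Rightarrow> real"
  assumes "n \<ge> 1"
    and "continuous_on UNIV \<gamma>1" and "continuous_on UNIV \<gamma>2"
    and "\<gamma>1 \<noteq> \<gamma>2" and "\<not> fun_dependent {\<gamma>1, \<gamma>2}"
    and "translation_invariant \<gamma>1 \<gamma>2"
    and "lin_indep_family (GG \<gamma>1 \<gamma>2 h n) {0..n}"
    and "G \<in> pi_space \<gamma>1 \<gamma>2 n"
    and "is_blossom \<gamma>1 \<gamma>2 h n G g"
    and "h \<noteq> 0"
  shows "card {\<sigma>. \<sigma> permutes {1..n}} = fact n \<and>
    (\<forall>\<sigma> a b.
       \<sigma> permutes {1..n} \<longrightarrow>
       (\<forall>i j. i \<le> j \<and> j \<le> n - 1 \<longrightarrow> dd \<gamma>1 \<gamma>2 (a - real j * h) (b - real i * h) \<noteq> 0) \<longrightarrow>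
       (\<forall>x.
          (\<forall>k \<le> n. \<forall>i \<le> n - k.
             PP \<gamma>1 \<gamma>2 h n g a b \<sigma> k i x
               = g (ab_args \<gamma>1 \<gamma>2 h n a b (k + i) i @ x_args \<gamma>1 \<gamma>2 h \<sigma> k x)) \<and>
          PP \<gamma>1 \<gamma>2 h n g a b \<sigma> n 0 x = g (x_args \<gamma>1 \<gamma>2 h \<sigma> n x) \<and>
          g (x_args \<gamma>1 \<gamma>2 h \<sigma> n x) = G x))"
proof (intro conjI allI impI)
  show "card {\<sigma>. \<sigma> permutes {1..n}} = fact n"
    by (simp add: card_permutations)
next
  have sym: "symmetric_fun n g" and multi: "multilinear_fun n g"
    and diag: "g (map (\<lambda>j. curve \<gamma>1 \<gamma>2 (t - real j * h)) [0..<n]) = G t" for t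
    using \<open>is_blossom \<gamma>1 \<gamma>2 h n G g\<close> by (auto simp: is_blossom_def)
  fix \<sigma> a b x
  assume perm: "\<sigma> permutes {1..n}"
    and nz: "\<forall>i j. i \<le> j \<and> j \<le> n - 1 \<longrightarrow> dd \<gamma>1 \<gamma>2 (a - real j * h) (b - real i * h) \<noteq> 0"
  have PP: "PP \<gamma>1 \<gamma>2 h n g a b \<sigma> k i x =
      g (ab_args \<gamma>1 \<gamma>2 h n a b (k + i) i @ x_args \<gamma>1 \<gamma>2 h \<sigma> k x)" if "i + k \<le> n" for k i
    using nz that by (intro PP_eq_blossom[OF sym multi]) auto
  then show "PP \<gamma>1 \<gamma>2 h n g a b \<sigma> k i x =
      g (ab_args \<gamma>1 \<gamma>2 h n a b (k + i) i @ x_args \<gamma>1 \<gamma>2 h \<sigma> k x)"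
    if "k \<le> n" "i \<le> n - k" for k i
    using that by simp
  show "PP \<gamma>1 \<gamma>2 h n g a b \<sigma> n 0 x = g (x_args \<gamma>1 \<gamma>2 h \<sigma> n x)"
    \<comment> \<open>For \<open>k = n\<close> and \<open>i = 0\<close> the \<open>a\<close> and
      \<open>b\<close> blocks are both empty.\<close>
    using PP[of 0 n] by (simp add: ab_args_def)
  show "g (x_args \<gamma>1 \<gamma>2 h \<sigma> n x) = G x"
    \<comment> \<open>Sorting the shifts of \<open>x\<close> by symmetry gives the diagonal list,
      where the blossom equals \<open>G x\<close>.\<close>
    using symmetric_fun_mset_cong[OF sym _ mset_x_args_permutes[OF perm]] diag by simp
qed

end
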